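(* Let $0\le u_0\in L^1(\mathbb{R}^N)\cap L^\infty(\mathbb{R}^N)$ with $u_0=0$ in $\mathcal{H}$, let $u$ be the solution of the nonlocal problem with initial datum $u_0$, and let $\phi$ be the solution of the stationary problem. Then $$\int_{\mathbb{R}^N}u(x,t)\phi(x)\,dx=\int_{\mathbb{R}^N}u_0(x)\phi(x)\,dx\quad\text{for every } t>0.$$
   Context: Setting: $N\ge 3$; $\mathcal{H}\subset\mathbb{R}^N$ is a bounded open set with smooth boundary (not necessarily connected), $0\in\mathcal{H}$, and $\Omega=\mathbb{R}^N\setminus\mathcal{H}$. The kernel $J:\mathbb{R}^N\to[0,\infty)$ is smooth, radially symmetric, compactly supported in the unit ball centered at the origin, with $J(0)>0$ and $\int_{\mathbb{R}^N}J=1$. Nonlocal problem: $\partial_t u(x,t)=\int_{\mathbb{R}^N}J(x-y)(u(y,t)-u(x,t))\,dy$ in $\Omega\times(0,\infty)$, $u=0$ in $\mathcal{H}\times(0,\infty)$, $u(\cdot,0)=u_0$. A solution is a function $u\in C([0,\infty);L^1(\mathbb{R}^N))$ such that for all $t>0$, $u(\cdot,t)=u_0+\int_0^t(J*u(\cdot,s)-u(\cdot,s))\,ds$ a.e. in $\Omega$ and $u(\cdot,t)=0$ a.e. in $\mathcal{H}$; it exists and is unique. Stationary problem: $\phi\in L^1_{\rm loc}(\mathbb{R}^N)$ is the unique solution of $J*\phi=\phi$ in $\Omega$, $\phi=0$ in $\mathcal{H}$, $\phi(x)\to1$ as $|x|\to\infty$. *)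

theory Defs
  imports "HOL-Analysis.Analysis"
begin

section \<open>The Banach space of classes of Lebesgue integrable functions\<close>

definition L1_rel :: "('a::euclidean_space \<Rightarrow> real) \<Rightarrow> ('a \<Rightarrow> real) \<Rightarrow> bool" where
  "L1_rel f g \<longleftrightarrow> integrable lebesgue f \<and> integrable lebesgue g \<and> (AE x in lebesgue. f x = g x)"

quotient_type (overloaded) 'a L1 = "'a::euclidean_space \<Rightarrow> real" / partial: L1_rel
  morphisms L1_fun L1_class
proof (rule part_equivpI)
  show "\<exists>f::'a \<Rightarrow> real. L1_rel f f"
    by (rule exI[of _ "\<lambda>_. 0"]) (simp add: L1_rel_def)
  show "symp (L1_rel :: ('a \<Rightarrow> real) \<Rightarrow> _)"
    by (rule sympI) (auto simp: L1_rel_def)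
  show "transp (L1_rel :: ('a \<Rightarrow> real) \<Rightarrow> _)"
    by (rule transpI) (auto simp: L1_rel_def)
qed

lemma L1_rel_refl: "L1_rel f f \<longleftrightarrow> integrable lebesgue f"
  by (simp add: L1_rel_def)

lemma L1_rel_L1_fun: "L1_rel (L1_fun u) (L1_fun u)"
  by (rule Quotient3_rep_reflp[OF Quotient3_L1])

lemma integrable_L1_fun: "integrable lebesgue (L1_fun u)"
  using L1_rel_L1_fun[of u] by (simp add: L1_rel_refl)

lemma L1_class_L1_fun [simp]: "L1_class (L1_fun u) = u"
  by (rule Quotient3_abs_rep[OF Quotient3_L1])

lemma L1_class_eq_iff:
  assumes "integrable lebesgue f" "integrable lebesgue g"
  shows "L1_class f = L1_class g \<longleftrightarrow> (AE x in lebesgue. f x = g x)"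
  using Quotient3_rel[OF Quotient3_L1, of f g] assms by (simp add: L1_rel_def)

lemma L1_fun_L1_class:
  assumes "integrable lebesgue f"
  shows "AE x in lebesgue. L1_fun (L1_class f) x = f x"
  using L1_class_eq_iff[OF integrable_L1_fun assms] L1_class_L1_fun by blast

instantiation L1 :: (euclidean_space) real_vector
begin

lift_definition zero_L1 :: "'a L1" is "\<lambda>_. 0"
  by (simp add: L1_rel_def)

lift_definition plus_L1 :: "'a L1 \<Rightarrow> 'a L1 \<Rightarrow> 'a L1" is "\<lambda>f g x. f x + g x"
  by (auto simp: L1_rel_def)

lift_definition minus_L1 :: "'a L1 \<Rightarrow> 'a L1 \<Rightarrow> 'a L1" is "\<lambda>f g x. f x - g x"
  by (auto simp: L1_rel_def)

lift_definition uminus_L1 :: "'a L1 \<Rightarrow> 'a L1" is "\<lambda>f x. - f x"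
  by (auto simp: L1_rel_def)

lift_definition scaleR_L1 :: "real \<Rightarrow> 'a L1 \<Rightarrow> 'a L1" is "\<lambda>c f x. c * f x"
  by (auto simp: L1_rel_def)

instance
  by standard (transfer; auto simp: L1_rel_def algebra_simps)+

end

instantiation L1 :: (euclidean_space) real_normed_vector
begin

lift_definition norm_L1 :: "'a L1 \<Rightarrow> real" is "\<lambda>f. \<integral>x. \<bar>f x\<bar> \<partial>lebesgue"
  by (rule integral_cong_AE) (auto simp: L1_rel_def)

definition dist_L1 :: "'a L1 \<Rightarrow> 'a L1 \<Rightarrow> real" where
  "dist_L1 u v = norm (u - v)"

definition sgn_L1 :: "'a L1 \<Rightarrow> 'a L1" where
  "sgn_L1 u = u /\<^sub>R norm u"

definition uniformity_L1 :: "('a L1 \<times> 'a L1) filter" where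
  "uniformity_L1 = (INF e\<in>{0<..}. principal {(u, v). dist u v < e})"

definition open_L1 :: "'a L1 set \<Rightarrow> bool" where
  "open_L1 S = (\<forall>u\<in>S. \<forall>\<^sub>F (u', v) in uniformity. u' = u \<longrightarrow> v \<in> S)"

instance
proof
  fix u v :: "'a L1" and c :: real
  show "dist u v = norm (u - v)"
    by (rule dist_L1_def)
  show "sgn u = u /\<^sub>R norm u"
    by (rule sgn_L1_def)
  show "(uniformity :: ('a L1 \<times> 'a L1) filter) = (INF e\<in>{0<..}. principal {(u, v). dist u v < e})"
    by (rule uniformity_L1_def)
  show "open S = (\<forall>u\<in>S. \<forall>\<^sub>F (u', v) in uniformity. u' = u \<longrightarrow> v \<in> S)" for S :: "'a L1 set"
    by (rule open_L1_def)
  show "norm u = 0 \<longleftrightarrow> u = 0"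
  proof transfer
    fix f :: "'a \<Rightarrow> real" assume "L1_rel f f"
    then have "integrable lebesgue f" by (simp add: L1_rel_refl)
    moreover from this have "(\<integral>x. \<bar>f x\<bar> \<partial>lebesgue) = 0 \<longleftrightarrow> (AE x in lebesgue. \<bar>f x\<bar> = 0)"
      by (intro integral_nonneg_eq_0_iff_AE integrable_abs) auto
    ultimately show "(\<integral>x. \<bar>f x\<bar> \<partial>lebesgue) = 0 \<longleftrightarrow> L1_rel f (\<lambda>_. 0)"
      unfolding L1_rel_def by auto
  qed
  show "norm (u + v) \<le> norm u + norm v"
  proof transfer
    fix f g :: "'a \<Rightarrow> real" assume "L1_rel f f" "L1_rel g g"
    then have [simp]: "integrable lebesgue f" "integrable lebesgue g"
      by (simp_all add: L1_rel_refl)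
    have "(\<integral>x. \<bar>f x + g x\<bar> \<partial>lebesgue) \<le> (\<integral>x. \<bar>f x\<bar> + \<bar>g x\<bar> \<partial>lebesgue)"
      by (intro integral_mono) auto
    then show "(\<integral>x. \<bar>f x + g x\<bar> \<partial>lebesgue) \<le> (\<integral>x. \<bar>f x\<bar> \<partial>lebesgue) + (\<integral>x. \<bar>g x\<bar> \<partial>lebesgue)"
      by simp
  qed
  show "norm (c *\<^sub>R u) = \<bar>c\<bar> * norm u"
    by transfer (simp add: abs_mult)
qed

end

lemma norm_L1_class:
  assumes "integrable lebesgue f"
  shows "norm (L1_class f) = (\<integral>x. \<bar>f x\<bar> \<partial>lebesgue)"
  using assms by (simp add: norm_L1.abs_eq L1_rel_refl)

lemma L1_class_diff:
  assumes "integrable lebesgue f" "integrable lebesgue g"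
  shows "L1_class f - L1_class g = L1_class (\<lambda>x. f x - g x)"
  using assms by (simp add: minus_L1.abs_eq L1_rel_refl)

lemma norm_L1_eq: "norm u = (\<integral>x. \<bar>L1_fun u x\<bar> \<partial>lebesgue)"
  using norm_L1_class[OF integrable_L1_fun[of u]] by simp

lemma norm_diff_L1_eq: "norm (u - v) = (\<integral>x. \<bar>L1_fun u x - L1_fun v x\<bar> \<partial>lebesgue)"
  using L1_class_diff[OF integrable_L1_fun[of u] integrable_L1_fun[of v]]
  by (simp add: norm_L1_class integrable_L1_fun)

instance L1 :: (euclidean_space) banach
proof
  fix X :: "nat \<Rightarrow> 'a L1"
  assume X: "Cauchy X"
  define s where "s n = L1_fun (X n)" for n
  have s: "integrable lebesgue (s n)" for n
    by (simp add: s_def integrable_L1_fun)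
  note [measurable] = borel_measurable_integrable[OF s]
  have C: "\<exists>N. \<forall>i\<ge>N. \<forall>j\<ge>N. (\<integral>x. norm (s i x - s j x) \<partial>lebesgue) < e" if e: "e > 0" for e
    using CauchyD[OF X e] by (simp add: s_def norm_diff_L1_eq)
  from cauchy_L1_AE_cauchy_subseq[OF s C] obtain r where
    r: "strict_mono r" and ae: "AE x in lebesgue. Cauchy (\<lambda>i. s (r i) x)" .
  define g where "g x = lim (\<lambda>i. s (r i) x)" for x
  have [measurable]: "g \<in> borel_measurable lebesgue"
    unfolding g_def by measurable
  have lim: "AE x in lebesgue. (\<lambda>i. s (r i) x) \<longlonglongrightarrow> g x"
    using ae by eventually_elim (simp add: g_def Cauchy_convergent_iff convergent_LIMSEQ_iff)
  have Fatou: "\<exists>N. \<forall>n\<ge>N. (\<integral>\<^sup>+x. ennreal \<bar>g x - s n x\<bar> \<partial>lebesgue) \<le> ennreal e" if e: "e > 0" for e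
  proof -
    obtain N where N: "\<And>i j. i \<ge> N \<Longrightarrow> j \<ge> N \<Longrightarrow> (\<integral>x. \<bar>s i x - s j x\<bar> \<partial>lebesgue) < e"
      using C[OF e] by auto
    have "(\<integral>\<^sup>+x. ennreal \<bar>g x - s n x\<bar> \<partial>lebesgue) \<le> ennreal e" if n: "n \<ge> N" for n
    proof -
      have "(\<integral>\<^sup>+x. ennreal \<bar>g x - s n x\<bar> \<partial>lebesgue)
          = (\<integral>\<^sup>+x. liminf (\<lambda>i. ennreal \<bar>s (r i) x - s n x\<bar>) \<partial>lebesgue)"
      proof (rule nn_integral_cong_AE)
        show "AE x in lebesgue. ennreal \<bar>g x - s n x\<bar> = liminf (\<lambda>i. ennreal \<bar>s (r i) x - s n x\<bar>)"
          using lim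
        proof eventually_elim
          case (elim x)
          then have "(\<lambda>i. ennreal \<bar>s (r i) x - s n x\<bar>) \<longlonglongrightarrow> ennreal \<bar>g x - s n x\<bar>"
            by (intro tendsto_ennrealI tendsto_intros)
          then show ?case
            by (intro lim_imp_Liminf[symmetric]) simp_all
        qed
      qed
      also have "\<dots> \<le> liminf (\<lambda>i. \<integral>\<^sup>+x. ennreal \<bar>s (r i) x - s n x\<bar> \<partial>lebesgue)"
        by (rule nn_integral_liminf) measurable
      also have "\<dots> \<le> limsup (\<lambda>i. \<integral>\<^sup>+x. ennreal \<bar>s (r i) x - s n x\<bar> \<partial>lebesgue)"
        by (rule Liminf_le_Limsup) simp
      also have "\<dots> \<le> ennreal e"
      proof (rule Limsup_bounded, rule eventually_sequentiallyI[of N])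
        fix i assume "N \<le> i"
        then have "r i \<ge> N" using seq_suble[OF r, of i] by linarith
        have "(\<integral>\<^sup>+x. ennreal \<bar>s (r i) x - s n x\<bar> \<partial>lebesgue)
            = ennreal (\<integral>x. \<bar>s (r i) x - s n x\<bar> \<partial>lebesgue)"
          by (rule nn_integral_eq_integral) (auto simp: s)
        also have "\<dots> \<le> ennreal e"
          using N[OF \<open>r i \<ge> N\<close> n] by (intro ennreal_leI) simp
        finally show "(\<integral>\<^sup>+x. ennreal \<bar>s (r i) x - s n x\<bar> \<partial>lebesgue) \<le> ennreal e" .
      qed
      finally show ?thesis .
    qed
    then show ?thesis by blast
  qed
  obtain N where "(\<integral>\<^sup>+x. ennreal \<bar>g x - s N x\<bar> \<partial>lebesgue) \<le> ennreal 1"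
    using Fatou[of 1] by auto
  then have "(\<integral>\<^sup>+x. ennreal \<bar>g x - s N x\<bar> \<partial>lebesgue) < \<infinity>"
    by (rule le_less_trans) simp
  then have "integrable lebesgue (\<lambda>x. g x - s N x)"
    by (intro integrableI_bounded) auto
  from Bochner_Integration.integrable_add[OF this s[of N]] have g: "integrable lebesgue g"
    by simp
  have norm: "ennreal (norm (X n - L1_class g)) = (\<integral>\<^sup>+x. ennreal \<bar>g x - s n x\<bar> \<partial>lebesgue)" for n
  proof -
    have "X n - L1_class g = L1_class (\<lambda>x. s n x - g x)"
      using L1_class_diff[OF s[of n] g] by (simp add: s_def)
    then have "norm (X n - L1_class g) = (\<integral>x. \<bar>g x - s n x\<bar> \<partial>lebesgue)"
      by (simp add: norm_L1_class s g abs_minus_commute)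
    then show ?thesis
      by (simp add: nn_integral_eq_integral s g)
  qed
  have "X \<longlonglongrightarrow> L1_class g"
  proof (rule LIMSEQ_I)
    fix e :: real assume "e > 0"
    then obtain N where "\<forall>n\<ge>N. ennreal (norm (X n - L1_class g)) \<le> ennreal (e / 2)"
      using Fatou[of "e / 2"] by (auto simp: norm)
    moreover have "norm (X n - L1_class g) < e" if "ennreal (norm (X n - L1_class g)) \<le> ennreal (e / 2)" for n
      using that \<open>e > 0\<close> by (simp add: ennreal_le_iff)
    ultimately have "\<forall>n\<ge>N. norm (X n - L1_class g) < e"
      by blast
    then show "\<exists>N. \<forall>n\<ge>N. norm (X n - L1_class g) < e" by blast
  qed
  then show "convergent X" by (rule convergentI)
qed

section \<open>Smooth functions and domains with smooth boundary\<close>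

text \<open>Meant for open \<open>S\<close>: all partial derivatives of order at most \<open>k\<close> exist and are continuous on \<open>S\<close>.\<close>

primrec Ck_on :: "nat \<Rightarrow> 'a::euclidean_space set \<Rightarrow> ('a \<Rightarrow> real) \<Rightarrow> bool" where
  "Ck_on 0 S f \<longleftrightarrow> continuous_on S f"
| "Ck_on (Suc k) S f \<longleftrightarrow> (\<forall>x\<in>S. f differentiable (at x)) \<and>
     (\<forall>b\<in>Basis. Ck_on k S (\<lambda>x. frechet_derivative f (at x) b))"

definition smooth_on :: "'a::euclidean_space set \<Rightarrow> ('a \<Rightarrow> real) \<Rightarrow> bool" where
  "smooth_on S f \<longleftrightarrow> (\<forall>k. Ck_on k S f)"

text \<open>
  Near each of its boundary points \<open>H\<close> is a sublevel set of a smooth function with nonvanishing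
  derivative; in particular \<open>H\<close> lies locally on one side of its boundary.
\<close>

definition smooth_boundary :: "'a::euclidean_space set \<Rightarrow> bool" where
  "smooth_boundary H \<longleftrightarrow> (\<forall>p\<in>frontier H. \<exists>U \<rho>. open U \<and> p \<in> U \<and> smooth_on U \<rho> \<and>
     (\<forall>x\<in>U. frechet_derivative \<rho> (at x) \<noteq> (\<lambda>_. 0)) \<and> H \<inter> U = {x \<in> U. \<rho> x < 0})"

section \<open>The nonlocal problem and the stationary problem\<close>

definition hole :: "'a::euclidean_space set \<Rightarrow> bool" where
  "hole H \<longleftrightarrow> open H \<and> bounded H \<and> smooth_boundary H \<and> 0 \<in> H"

definition nonlocal_kernel :: "('a::euclidean_space \<Rightarrow> real) \<Rightarrow> bool" where
  "nonlocal_kernel J \<longleftrightarrow>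
     (\<forall>x. 0 \<le> J x) \<and> smooth_on UNIV J \<and> (\<forall>x y. norm x = norm y \<longrightarrow> J x = J y) \<and>
     closure {x. J x \<noteq> 0} \<subseteq> cball 0 1 \<and> J 0 > 0 \<and> (\<integral>x. J x \<partial>lebesgue) = 1"

definition conv :: "('a::euclidean_space \<Rightarrow> real) \<Rightarrow> ('a \<Rightarrow> real) \<Rightarrow> 'a \<Rightarrow> real" where
  "conv J f x = (\<integral>y. J (x - y) * f y \<partial>lebesgue)"

lemma nonlocal_kernel_integrable:
  assumes "nonlocal_kernel J"
  shows "integrable lborel J"
proof -
  have "Ck_on 0 UNIV J" and supp: "closure {x. J x \<noteq> 0} \<subseteq> cball 0 1"
    using assms unfolding nonlocal_kernel_def smooth_on_def by blast+
  then have "continuous_on UNIV J"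
    by (simp only: Ck_on.simps(1))
  then have "continuous_on (cball 0 1) J"
    by (rule continuous_on_subset) (rule subset_UNIV)
  then have "integrable lborel (\<lambda>x. indicator (cball 0 1) x *\<^sub>R J x)"
    by (rule borel_integrable_compact[OF compact_cball])
  moreover have "indicator (cball 0 1) x *\<^sub>R J x = J x" for x
  proof (cases "J x = 0")
    case False
    then have "x \<in> cball 0 1"
      using supp closure_subset[of "{x. J x \<noteq> 0}"] by blast
    then show ?thesis
      by (simp only: indicator_simps scaleR_one)
  qed simp
  ultimately show ?thesis by (simp only:)
qed

lemma integrable_conv:
  assumes J: "integrable lborel J" and f: "integrable lebesgue f"
  shows "integrable lebesgue (conv J f)"
proof -
  obtain g where g[measurable]: "g \<in> borel_measurable lborel" and fg: "AE x in lborel. f x = g x"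
    using completion_ex_borel_measurable_real[OF borel_measurable_integrable[OF f]] by blast
  have fg': "AE x in lebesgue. f x = g x"
    using fg by (rule AE_completion)
  have "integrable lebesgue g"
    using integrable_cong_AE_imp[OF f _ fg'] g by (simp add: measurable_completion)
  then have g_int: "integrable lborel g"
    using g by (simp add: integrable_completion)
  have J_meas[measurable]: "J \<in> borel_measurable borel"
    using borel_measurable_integrable[OF J] by simp
  have shift: "integrable lborel (\<lambda>x. J (x - y))" "(\<integral>x. \<bar>J (x - y)\<bar> \<partial>lborel) = (\<integral>x. \<bar>J x\<bar> \<partial>lborel)" for y
  proof -
    have distr: "distr lborel borel ((+) (- y)) = (lborel :: 'a measure)"
      by (rule lborel_distr_plus)
    show "integrable lborel (\<lambda>x. J (x - y))"
      using J integrable_distr_eq[of "(+) (- y)" lborel borel J] by (simp add: distr)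
    show "(\<integral>x. \<bar>J (x - y)\<bar> \<partial>lborel) = (\<integral>x. \<bar>J x\<bar> \<partial>lborel)"
      using integral_distr[of "(+) (- y)" lborel borel "\<lambda>x. \<bar>J x\<bar>"] by (simp add: distr)
  qed
  have "integrable (lborel \<Otimes>\<^sub>M lborel) (\<lambda>(y, x). J (x - y) * g y)"
  proof (rule lborel_pair.Fubini_integrable)
    show "integrable lborel (\<lambda>y. \<integral>x. norm (case (y, x) of (y, x) \<Rightarrow> J (x - y) * g y) \<partial>lborel)"
      using g_int by (simp add: abs_mult shift)
    show "AE y in lborel. integrable lborel (\<lambda>x. case (y, x) of (y, x) \<Rightarrow> J (x - y) * g y)"
      using shift by simp
  qed measurable
  then have int: "integrable lborel (\<lambda>x. \<integral>y. J (x - y) * g y \<partial>lborel)"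
    using lborel_pair.integrable_snd by fastforce
  have "conv J f x = (\<integral>y. J (x - y) * g y \<partial>lborel)" for x
  proof -
    have "conv J f x = (\<integral>y. J (x - y) * g y \<partial>lebesgue)"
      unfolding conv_def
    proof (rule integral_cong_AE)
      have Jx: "(\<lambda>y. J (x - y)) \<in> borel_measurable lebesgue"
        by (rule measurable_completion) simp
      show "(\<lambda>y. J (x - y) * f y) \<in> borel_measurable lebesgue"
        using Jx borel_measurable_integrable[OF f] by (rule borel_measurable_times)
      show "(\<lambda>y. J (x - y) * g y) \<in> borel_measurable lebesgue"
        by (rule measurable_completion) simp
      show "AE y in lebesgue. J (x - y) * f y = J (x - y) * g y"
        using fg' by eventually_elim simp
    qed
    also have "\<dots> = (\<integral>y. J (x - y) * g y \<partial>lborel)"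
      by (rule integral_completion) measurable
    finally show ?thesis .
  qed
  then have "conv J f = (\<lambda>x. \<integral>y. J (x - y) * g y \<partial>lborel)"
    by blast
  with int show ?thesis
    by (simp add: integrable_completion)
qed

text \<open>
  A solution is an \<open>L1\<close>-valued curve, and its time integral is taken in the Banach space of classes.
  \<open>L1_class\<close> is meaningful on integrable functions only; \<open>integrable_conv\<close> covers its use here.
\<close>

definition nonlocal_solution ::
  "('a::euclidean_space \<Rightarrow> real) \<Rightarrow> 'a set \<Rightarrow> ('a \<Rightarrow> real) \<Rightarrow> (real \<Rightarrow> 'a L1) \<Rightarrow> bool" where
  "nonlocal_solution J H u0 u \<longleftrightarrow> continuous_on {0..} u \<and>
     (\<forall>t>0.
        (AE x in lebesgue. x \<in> - H \<longrightarrow>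
           L1_fun (u t) x = u0 x + L1_fun (integral {0..t} (\<lambda>s. L1_class (conv J (L1_fun (u s))) - u s)) x) \<and>
        (AE x in lebesgue. x \<in> H \<longrightarrow> L1_fun (u t) x = 0))"

text \<open>
  As \<open>\<phi>\<close> is only a locally integrable function, the equations hold almost everywhere and the
  limit at infinity is an essential one.
\<close>

definition stationary_solution ::
  "('a::euclidean_space \<Rightarrow> real) \<Rightarrow> 'a set \<Rightarrow> ('a \<Rightarrow> real) \<Rightarrow> bool" where
  "stationary_solution J H \<phi> \<longleftrightarrow>
     (\<forall>K. compact K \<longrightarrow> set_integrable lebesgue K \<phi>) \<and>
     (AE x in lebesgue. x \<in> - H \<longrightarrow> conv J \<phi> x = \<phi> x) \<and>
     (AE x in lebesgue. x \<in> H \<longrightarrow> \<phi> x = 0) \<and>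
     (\<forall>\<epsilon>>0. \<exists>R. AE x in lebesgue. norm x > R \<longrightarrow> \<bar>\<phi> x - 1\<bar> < \<epsilon>)"

end

theory Submission
  imports Defs
begin

text \<open>
  Formally, \<open>d/dt \<integral> u \<phi> = \<integral> (J * u - u) \<phi> = \<integral> u (J * \<phi> - \<phi>) = 0\<close>: the first equality may ignore the
  hole because \<open>\<phi>\<close> vanishes there, the second is the self-adjointness of convolution with an even
  kernel, and in the last integral \<open>u\<close> vanishes in the hole while \<open>J * \<phi> = \<phi>\<close> outside it.

  What makes this rigorous is that \<open>\<phi>\<close> is essentially bounded (\<open>stationary_solution_ess_bounded\<close>).
  Far away this follows from the limit at infinity.  On a ball, \<open>\<phi>\<close> is either zero or equal to
  \<open>J * \<phi>\<close>, and the latter is bounded there because \<open>J\<close> is bounded with compact support and \<open>\<phi>\<close> is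
  locally integrable.  Hence all the pairings converge, Fubini's theorem applies
  (\<open>conv_self_adjoint\<close>), and pairing with \<open>\<phi>\<close> is a bounded linear functional on the space of
  integrable classes (\<open>bounded_linear_L1_pairing\<close>).  Convolution with \<open>J\<close> is a contraction of that
  space (\<open>bounded_linear_conv_L1\<close>), so the integrand \<open>J * u - u\<close> of the evolution equation is a
  continuous curve, and the functional may be moved inside its time integral.  There it gives zero
  at every positive time (\<open>weighted_mass_flux_zero\<close>).
\<close>

section \<open>The convolution operator\<close>

lemma conv_cong_AE:
  assumes [measurable]: "J \<in> borel_measurable borel"
    and f: "f \<in> borel_measurable lebesgue" and g: "g \<in> borel_measurable lebesgue"
    and eq: "AE x in lebesgue. f x = g x"
  shows "conv J f = conv J g"
proof
  fix x
  have J: "(\<lambda>y. J (x - y)) \<in> borel_measurable lebesgue"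
    by (rule measurable_completion) simp
  have "AE y in lebesgue. J (x - y) * f y = J (x - y) * g y"
    using eq by eventually_elim simp
  then show "conv J f x = conv J g x"
    unfolding conv_def
    by (intro integral_cong_AE borel_measurable_times J f g)
qed

lemma conv_eq_lborel:
  assumes [measurable]: "J \<in> borel_measurable borel" "h \<in> borel_measurable borel"
  shows "conv J h x = (\<integral>y. J (x - y) * h y \<partial>lborel)"
  unfolding conv_def by (rule integral_completion) measurable

lemma integrable_shifted_kernel:
  fixes J :: "'a::euclidean_space \<Rightarrow> real"
  assumes J: "integrable lborel J"
  shows "integrable lborel (\<lambda>x. J (x - y))"
    and "(\<integral>x. J (x - y) \<partial>lborel) = (\<integral>x. J x \<partial>lborel)"
    and "(\<integral>x. \<bar>J (x - y)\<bar> \<partial>lborel) = (\<integral>x. \<bar>J x\<bar> \<partial>lborel)"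
proof -
  have [measurable]: "J \<in> borel_measurable borel"
    using borel_measurable_integrable[OF J] by simp
  have distr: "distr lborel borel ((+) (- y)) = (lborel :: 'a measure)"
    by (rule lborel_distr_plus)
  show "integrable lborel (\<lambda>x. J (x - y))"
    using J integrable_distr_eq[of "(+) (- y)" lborel borel J] by (simp add: distr)
  show "(\<integral>x. J (x - y) \<partial>lborel) = (\<integral>x. J x \<partial>lborel)"
    using integral_distr[of "(+) (- y)" lborel borel J] by (simp add: distr)
  show "(\<integral>x. \<bar>J (x - y)\<bar> \<partial>lborel) = (\<integral>x. \<bar>J x\<bar> \<partial>lborel)"
    using integral_distr[of "(+) (- y)" lborel borel "\<lambda>x. \<bar>J x\<bar>"] by (simp add: distr)
qed

text \<open>
  Fubini's theorem for \<open>J (x - y) * f y * g x\<close>, which is integrable on the product because \<open>g\<close> is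
  essentially bounded and \<open>J\<close> has finite mass; evenness of \<open>J\<close> lets the inner integral over \<open>x\<close> be
  read as a convolution again.
\<close>

lemma conv_self_adjoint_borel:
  fixes J :: "'a::euclidean_space \<Rightarrow> real"
  assumes J: "integrable lborel J" and even: "\<And>x. J (- x) = J x"
    and f: "integrable lborel f"
    and g[measurable]: "g \<in> borel_measurable borel" and C: "AE x in lborel. \<bar>g x\<bar> \<le> C"
  shows "(\<integral>x. conv J f x * g x \<partial>lborel) = (\<integral>y. f y * conv J g y \<partial>lborel)"
proof -
  have [measurable]: "J \<in> borel_measurable borel" "f \<in> borel_measurable borel"
    using borel_measurable_integrable[OF J] borel_measurable_integrable[OF f] by simp_all
  have dominating: "integrable (lborel \<Otimes>\<^sub>M lborel) (\<lambda>(y, x). C * (J (x - y) * f y))"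
  proof (rule lborel_pair.Fubini_integrable)
    show "integrable lborel (\<lambda>y. \<integral>x. norm (case (y, x) of (y, x) \<Rightarrow> C * (J (x - y) * f y)) \<partial>lborel)"
      using f by (simp add: abs_mult integrable_shifted_kernel[OF J])
    show "AE y in lborel. integrable lborel (\<lambda>x. case (y, x) of (y, x) \<Rightarrow> C * (J (x - y) * f y))"
      using integrable_shifted_kernel[OF J] by simp
  qed measurable
  have C': "AE p in lborel \<Otimes>\<^sub>M lborel. \<bar>g (snd p)\<bar> \<le> C"
  proof (rule lborel_pair.AE_pair_measure)
    show "{p \<in> space (lborel \<Otimes>\<^sub>M lborel). \<bar>g (snd p)\<bar> \<le> C} \<in> sets (lborel \<Otimes>\<^sub>M (lborel :: 'a measure))"
      by measurable
    show "AE x in lborel. AE y in lborel. \<bar>g (snd (x, y))\<bar> \<le> C"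
      using C by simp
  qed
  have int: "integrable (lborel \<Otimes>\<^sub>M lborel) (\<lambda>(y, x). J (x - y) * f y * g x)"
  proof (rule Bochner_Integration.integrable_bound[OF dominating])
    show "AE p in lborel \<Otimes>\<^sub>M lborel. norm (case p of (y, x) \<Rightarrow> J (x - y) * f y * g x)
        \<le> norm (case p of (y, x) \<Rightarrow> C * (J (x - y) * f y))"
      using C'
    proof eventually_elim
      case (elim p)
      obtain y x where p: "p = (y, x)" by (cases p)
      have "\<bar>J (x - y) * f y\<bar> * \<bar>g x\<bar> \<le> \<bar>J (x - y) * f y\<bar> * \<bar>C\<bar>"
        using elim p by (intro mult_left_mono) auto
      then show ?case by (simp add: p abs_mult mult_ac)
    qed
  qed measurable
  have "(\<integral>x. conv J f x * g x \<partial>lborel) = (\<integral>x. (\<integral>y. J (x - y) * f y * g x \<partial>lborel) \<partial>lborel)"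
    by (simp add: conv_eq_lborel)
  also have "\<dots> = (\<integral>y. (\<integral>x. J (x - y) * f y * g x \<partial>lborel) \<partial>lborel)"
    by (rule lborel_pair.Fubini_integral[OF int])
  also have "\<dots> = (\<integral>y. f y * conv J g y \<partial>lborel)"
  proof (rule Bochner_Integration.integral_cong[OF refl])
    fix y
    have "J (x - y) * f y * g x = f y * (J (y - x) * g x)" for x
      using even[of "y - x"] by (simp add: mult_ac)
    then have "(\<integral>x. J (x - y) * f y * g x \<partial>lborel) = (\<integral>x. f y * (J (y - x) * g x) \<partial>lborel)"
      by presburger
    then show "(\<integral>x. J (x - y) * f y * g x \<partial>lborel) = f y * conv J g y"
      by (simp add: conv_eq_lborel)
  qed
  finally show ?thesis .
qed

text \<open>
  The completed measure \<open>lebesgue\<close> is not a product measure, so Fubini's theorem is applied to Borel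
  representatives of \<open>f\<close> and \<open>g\<close>; passing to them changes neither the convolutions nor the integrals.
\<close>

lemma conv_self_adjoint:
  fixes J :: "'a::euclidean_space \<Rightarrow> real"
  assumes J: "integrable lborel J" and even: "\<And>x. J (- x) = J x"
    and f: "integrable lebesgue f"
    and g: "g \<in> borel_measurable lebesgue" and C: "AE x in lebesgue. \<bar>g x\<bar> \<le> C"
  shows "(\<integral>x. conv J f x * g x \<partial>lebesgue) = (\<integral>y. f y * conv J g y \<partial>lebesgue)"
proof -
  have Jm[measurable]: "J \<in> borel_measurable borel"
    using borel_measurable_integrable[OF J] by simp
  obtain f' where f'[measurable]: "f' \<in> borel_measurable lborel" and ff': "AE x in lborel. f x = f' x"
    using completion_ex_borel_measurable_real[OF borel_measurable_integrable[OF f]] by blast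
  obtain g' where g'[measurable]: "g' \<in> borel_measurable lborel" and gg': "AE x in lborel. g x = g' x"
    using completion_ex_borel_measurable_real[OF g] by blast
  have fm: "f' \<in> borel_measurable lebesgue" "g' \<in> borel_measurable lebesgue"
    by (simp_all add: measurable_completion)
  have ffL: "AE x in lebesgue. f x = f' x" and ggL: "AE x in lebesgue. g x = g' x"
    using ff' gg' by (auto intro: AE_completion)
  have f'L: "integrable lebesgue f'"
    using integrable_cong_AE_imp[OF f fm(1)] ffL by auto
  then have f'i: "integrable lborel f'"
    by (simp add: integrable_completion)
  have C': "AE x in lborel. \<bar>g' x\<bar> \<le> C"
  proof -
    have "AE x in lebesgue. \<bar>g' x\<bar> \<le> C"
      using C ggL by eventually_elim simp
    then show ?thesis by (simp add: AE_completion_iff)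
  qed
  have cf: "conv J f = conv J f'" and cg: "conv J g = conv J g'"
    using conv_cong_AE[OF Jm] borel_measurable_integrable[OF f] fm g ffL ggL by blast+
  have conv_meas: "conv J h \<in> borel_measurable borel" if [measurable]: "h \<in> borel_measurable borel" for h
  proof -
    have "conv J h = (\<lambda>x. \<integral>y. J (x - y) * h y \<partial>lborel)"
      using conv_eq_lborel[OF Jm that] by blast
    then show ?thesis by simp
  qed
  have [measurable]: "conv J f' \<in> borel_measurable borel" "conv J g' \<in> borel_measurable borel"
    using conv_meas f' g' by simp_all
  have cm: "conv J f' \<in> borel_measurable lebesgue" "conv J g' \<in> borel_measurable lebesgue"
    by (simp_all add: measurable_completion)
  have "(\<integral>x. conv J f x * g x \<partial>lebesgue) = (\<integral>x. conv J f' x * g' x \<partial>lebesgue)"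
    unfolding cf using ggL
    by (intro integral_cong_AE borel_measurable_times cm fm g) auto
  also have "\<dots> = (\<integral>x. conv J f' x * g' x \<partial>lborel)"
    by (rule integral_completion) measurable
  also have "\<dots> = (\<integral>y. f' y * conv J g' y \<partial>lborel)"
    using conv_self_adjoint_borel[OF J even f'i _ C'] by simp
  also have "\<dots> = (\<integral>y. f' y * conv J g' y \<partial>lebesgue)"
    by (rule integral_completion[symmetric]) measurable
  also have "\<dots> = (\<integral>y. f y * conv J g y \<partial>lebesgue)"
    unfolding cg using ffL borel_measurable_integrable[OF f]
    by (intro integral_cong_AE borel_measurable_times cm fm) auto
  finally show ?thesis .
qed

section \<open>Elementary properties of the kernel\<close>

lemma nonlocal_kernel_even: "nonlocal_kernel J \<Longrightarrow> J (- x) = J x"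
  unfolding nonlocal_kernel_def by (metis norm_minus_cancel)

lemma nonlocal_kernel_support:
  assumes "nonlocal_kernel J" and "norm x > 1"
  shows "J x = 0"
proof (rule ccontr)
  assume "J x \<noteq> 0"
  then have "x \<in> cball 0 1"
    using assms(1) closure_subset[of "{x. J x \<noteq> 0}"] unfolding nonlocal_kernel_def by blast
  with assms(2) show False by simp
qed

lemma nonlocal_kernel_bounded:
  assumes J: "nonlocal_kernel J"
  obtains M where "M \<ge> 0" "\<And>x. \<bar>J x\<bar> \<le> M"
proof -
  have "Ck_on 0 UNIV J"
    using J unfolding nonlocal_kernel_def smooth_on_def by blast
  then have "continuous_on (cball 0 1) J"
    by (auto intro: continuous_on_subset)
  then have "bounded (J ` cball 0 1)"
    by (intro compact_imp_bounded compact_continuous_image) auto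
  then obtain M where M: "\<And>x. x \<in> cball 0 1 \<Longrightarrow> \<bar>J x\<bar> \<le> M"
    unfolding bounded_iff ball_simps real_norm_def by blast
  have "\<bar>J x\<bar> \<le> max M 0" for x
    using M[of x] nonlocal_kernel_support[OF J, of x] by (cases "norm x \<le> 1") auto
  then show ?thesis
    using that[of "max M 0"] by simp
qed

lemma integrable_kernel_times:
  assumes J: "nonlocal_kernel J" and f: "integrable lebesgue f"
  shows "integrable lebesgue (\<lambda>y. J (x - y) * f y)"
proof -
  obtain M where M: "M \<ge> 0" "\<And>x. \<bar>J x\<bar> \<le> M"
    using nonlocal_kernel_bounded[OF J] by blast
  have [measurable]: "J \<in> borel_measurable borel"
    using borel_measurable_integrable[OF nonlocal_kernel_integrable[OF J]] by simp
  have Jx: "(\<lambda>y. J (x - y)) \<in> borel_measurable lebesgue"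
    by (rule measurable_completion) simp
  show ?thesis
  proof (rule Bochner_Integration.integrable_bound[of _ "\<lambda>y. M * f y"])
    show "integrable lebesgue (\<lambda>y. M * f y)"
      using f by simp
    show "(\<lambda>y. J (x - y) * f y) \<in> borel_measurable lebesgue"
      by (intro borel_measurable_times Jx borel_measurable_integrable f)
    show "AE y in lebesgue. norm (J (x - y) * f y) \<le> norm (M * f y)"
      using M by (auto simp: abs_mult intro!: mult_right_mono)
  qed
qed

lemma conv_one:
  assumes J: "nonlocal_kernel J"
  shows "conv J (\<lambda>_. 1) x = 1"
proof -
  note Ji = nonlocal_kernel_integrable[OF J]
  have [measurable]: "J \<in> borel_measurable borel"
    using borel_measurable_integrable[OF Ji] by simp
  have "conv J (\<lambda>_. 1) x = (\<integral>y. J (y - x) \<partial>lebesgue)"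
    using nonlocal_kernel_even[OF J] unfolding conv_def
    by (metis (no_types, lifting) minus_diff_eq mult.right_neutral)
  also have "\<dots> = (\<integral>y. J (y - x) \<partial>lborel)"
    by (rule integral_completion) measurable
  also have "\<dots> = (\<integral>y. J y \<partial>lebesgue)"
    using integrable_shifted_kernel(2)[OF Ji, of x] integral_completion[of J lborel] by simp
  also have "\<dots> = 1"
    using J unfolding nonlocal_kernel_def by blast
  finally show ?thesis .
qed

section \<open>Operators and functionals on classes of integrable functions\<close>

lemma L1_fun_add: "AE x in lebesgue. L1_fun (a + b) x = L1_fun a x + L1_fun b x"
proof -
  have "a + b = L1_class (\<lambda>x. L1_fun a x + L1_fun b x)"
    using plus_L1.abs_eq[OF L1_rel_L1_fun[of a] L1_rel_L1_fun[of b]] by simp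
  then show ?thesis
    using L1_fun_L1_class[of "\<lambda>x. L1_fun a x + L1_fun b x"] by (simp add: integrable_L1_fun)
qed

lemma L1_fun_diff: "AE x in lebesgue. L1_fun (a - b) x = L1_fun a x - L1_fun b x"
proof -
  have "a - b = L1_class (\<lambda>x. L1_fun a x - L1_fun b x)"
    using minus_L1.abs_eq[OF L1_rel_L1_fun[of a] L1_rel_L1_fun[of b]] by simp
  then show ?thesis
    using L1_fun_L1_class[of "\<lambda>x. L1_fun a x - L1_fun b x"] by (simp add: integrable_L1_fun)
qed

lemma L1_fun_scaleR: "AE x in lebesgue. L1_fun (c *\<^sub>R a) x = c * L1_fun a x"
proof -
  have "c *\<^sub>R a = L1_class (\<lambda>x. c * L1_fun a x)"
    using scaleR_L1.abs_eq[OF L1_rel_L1_fun[of a], of c] by simp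
  then show ?thesis
    using L1_fun_L1_class[of "\<lambda>x. c * L1_fun a x"] by (simp add: integrable_L1_fun)
qed

text \<open>
  The operator is a contraction: the mass of \<open>conv J \<bar>f\<bar>\<close> is that of \<open>\<bar>f\<bar>\<close>, by self-adjointness
  tested against the constant \<open>1\<close>, which \<open>conv J\<close> fixes.
\<close>

lemma integral_abs_conv_le:
  assumes J: "nonlocal_kernel J" and f: "integrable lebesgue f"
  shows "(\<integral>x. \<bar>conv J f x\<bar> \<partial>lebesgue) \<le> (\<integral>x. \<bar>f x\<bar> \<partial>lebesgue)"
proof -
  note Ji = nonlocal_kernel_integrable[OF J]
  have f': "integrable lebesgue (\<lambda>x. \<bar>f x\<bar>)"
    using f by simp
  have le: "\<bar>conv J f x\<bar> \<le> conv J (\<lambda>x. \<bar>f x\<bar>) x" for x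
  proof -
    have [simp]: "\<bar>J z\<bar> = J z" for z
      using J unfolding nonlocal_kernel_def by (blast intro: abs_of_nonneg)
    have "\<bar>conv J f x\<bar> \<le> (\<integral>y. \<bar>J (x - y) * f y\<bar> \<partial>lebesgue)"
      unfolding conv_def by (rule integral_abs_bound)
    also have "\<dots> = conv J (\<lambda>x. \<bar>f x\<bar>) x"
      by (simp add: conv_def abs_mult)
    finally show ?thesis .
  qed
  have "(\<integral>x. \<bar>conv J f x\<bar> \<partial>lebesgue) \<le> (\<integral>x. conv J (\<lambda>x. \<bar>f x\<bar>) x * 1 \<partial>lebesgue)"
    using le integrable_conv[OF Ji f] integrable_conv[OF Ji f'] by (intro integral_mono) auto
  also have "\<dots> = (\<integral>x. \<bar>f x\<bar> * conv J (\<lambda>_. 1) x \<partial>lebesgue)"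
    by (rule conv_self_adjoint[OF Ji nonlocal_kernel_even[OF J] f', where C = 1]) auto
  finally show ?thesis
    by (simp add: conv_one[OF J])
qed

lemma bounded_linear_conv_L1:
  assumes J: "nonlocal_kernel J"
  shows "bounded_linear (\<lambda>v. L1_class (conv J (L1_fun v)))"
proof (rule bounded_linear_intro[where K = 1])
  note Ji = nonlocal_kernel_integrable[OF J]
  have Jm: "J \<in> borel_measurable borel"
    using borel_measurable_integrable[OF Ji] by simp
  note meas = borel_measurable_integrable[OF integrable_L1_fun]
  note ic = integrable_conv[OF Ji integrable_L1_fun]
  have rel: "L1_rel (conv J (L1_fun a)) (conv J (L1_fun a))" for a
    using ic by (simp add: L1_rel_refl)
  fix a b :: "'a L1" and c :: real
  have "conv J (L1_fun (a + b)) = conv J (\<lambda>x. L1_fun a x + L1_fun b x)"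
    by (intro conv_cong_AE Jm meas L1_fun_add borel_measurable_add)
  also have "\<dots> = (\<lambda>x. conv J (L1_fun a) x + conv J (L1_fun b) x)"
    unfolding conv_def
    by (simp add: ring_distribs Bochner_Integration.integral_add integrable_kernel_times[OF J integrable_L1_fun])
  finally show "L1_class (conv J (L1_fun (a + b))) = L1_class (conv J (L1_fun a)) + L1_class (conv J (L1_fun b))"
    using plus_L1.abs_eq[OF rel[of a] rel[of b]] by simp
  have "conv J (L1_fun (c *\<^sub>R a)) = conv J (\<lambda>x. c * L1_fun a x)"
    by (intro conv_cong_AE Jm meas L1_fun_scaleR borel_measurable_times) auto
  also have "\<dots> = (\<lambda>x. c * conv J (L1_fun a) x)"
    unfolding conv_def by (simp add: mult.left_commute)
  finally show "L1_class (conv J (L1_fun (c *\<^sub>R a))) = c *\<^sub>R L1_class (conv J (L1_fun a))"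
    using scaleR_L1.abs_eq[OF rel[of a], of c] by simp
  show "norm (L1_class (conv J (L1_fun a))) \<le> norm a * 1"
    using integral_abs_conv_le[OF J integrable_L1_fun[of a]]
    unfolding norm_L1_class[OF ic] norm_L1_eq[of a] by simp
qed

lemma integrable_times_ess_bounded:
  assumes f: "integrable lebesgue f" and g: "g \<in> borel_measurable lebesgue"
    and C: "AE x in lebesgue. \<bar>g x\<bar> \<le> C"
  shows "integrable lebesgue (\<lambda>x. f x * g x :: real)"
proof (rule Bochner_Integration.integrable_bound[of _ "\<lambda>x. C * f x"])
  show "integrable lebesgue (\<lambda>x. C * f x)"
    using f by simp
  show "(\<lambda>x. f x * g x) \<in> borel_measurable lebesgue"
    by (intro borel_measurable_times g borel_measurable_integrable f)
  show "AE x in lebesgue. norm (f x * g x) \<le> norm (C * f x)"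
    using C
  proof eventually_elim
    case (elim x)
    then have "\<bar>g x\<bar> * \<bar>f x\<bar> \<le> \<bar>C\<bar> * \<bar>f x\<bar>"
      by (intro mult_right_mono) auto
    then show ?case by (simp add: abs_mult mult.commute)
  qed
qed

lemma bounded_linear_L1_pairing:
  assumes g: "g \<in> borel_measurable lebesgue" and C: "AE x in lebesgue. \<bar>g x\<bar> \<le> C"
  shows "bounded_linear (\<lambda>v. \<integral>x. L1_fun v x * g x \<partial>lebesgue)"
proof (rule bounded_linear_intro[where K = C])
  note int = integrable_times_ess_bounded[OF integrable_L1_fun g C]
  note meas = borel_measurable_integrable[OF int]
  fix a b :: "'a L1" and c :: real
  have "(\<integral>x. L1_fun (a + b) x * g x \<partial>lebesgue) = (\<integral>x. L1_fun a x * g x + L1_fun b x * g x \<partial>lebesgue)"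
    using L1_fun_add[of a b]
    by (intro integral_cong_AE meas borel_measurable_add) (auto simp: ring_distribs)
  then show "(\<integral>x. L1_fun (a + b) x * g x \<partial>lebesgue)
      = (\<integral>x. L1_fun a x * g x \<partial>lebesgue) + (\<integral>x. L1_fun b x * g x \<partial>lebesgue)"
    by (simp add: int)
  have "(\<integral>x. L1_fun (c *\<^sub>R a) x * g x \<partial>lebesgue) = (\<integral>x. c * (L1_fun a x * g x) \<partial>lebesgue)"
    using L1_fun_scaleR[of c a]
    by (intro integral_cong_AE meas borel_measurable_times) auto
  then show "(\<integral>x. L1_fun (c *\<^sub>R a) x * g x \<partial>lebesgue) = c *\<^sub>R (\<integral>x. L1_fun a x * g x \<partial>lebesgue)"
    by simp
  have "norm (\<integral>x. L1_fun a x * g x \<partial>lebesgue) \<le> (\<integral>x. \<bar>L1_fun a x\<bar> * C \<partial>lebesgue)"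
  proof (rule order_trans[OF integral_norm_bound], rule integral_mono_AE)
    show "AE x in lebesgue. norm (L1_fun a x * g x) \<le> \<bar>L1_fun a x\<bar> * C"
      using C by eventually_elim (simp add: abs_mult mult_left_mono)
  qed (simp_all add: int integrable_L1_fun)
  then show "norm (\<integral>x. L1_fun a x * g x \<partial>lebesgue) \<le> norm a * C"
    by (simp add: norm_L1_eq)
qed

section \<open>Bounds for the stationary solution\<close>

lemma borel_measurable_locally_integrable:
  fixes \<phi> :: "'a::euclidean_space \<Rightarrow> real"
  assumes loc: "\<And>K. compact K \<Longrightarrow> set_integrable lebesgue K \<phi>"
  shows "\<phi> \<in> borel_measurable lebesgue"
proof (rule borel_measurable_LIMSEQ_real)
  fix x :: 'a
  obtain N :: nat where N: "norm x \<le> real N"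
    using real_arch_simple by blast
  have "\<forall>\<^sub>F n in sequentially. indicator (cball 0 (real n)) x *\<^sub>R \<phi> x = \<phi> x"
    using eventually_ge_at_top[of N]
  proof eventually_elim
    case (elim n)
    then have "x \<in> cball 0 (real n)" using N by simp
    then show ?case by simp
  qed
  then show "(\<lambda>n. indicator (cball 0 (real n)) x *\<^sub>R \<phi> x) \<longlonglongrightarrow> \<phi> x"
    by (rule tendsto_eventually)
next
  fix n :: nat
  show "(\<lambda>x. indicator (cball 0 (real n)) x *\<^sub>R \<phi> x) \<in> borel_measurable lebesgue"
    using loc[OF compact_cball] unfolding set_integrable_def by (rule borel_measurable_integrable)
qed

lemma stationary_solutionD:
  assumes "stationary_solution J H \<phi>"
  shows "compact K \<Longrightarrow> set_integrable lebesgue K \<phi>"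
    and "AE x in lebesgue. x \<in> - H \<longrightarrow> conv J \<phi> x = \<phi> x"
    and "AE x in lebesgue. x \<in> H \<longrightarrow> \<phi> x = 0"
    and "\<epsilon> > 0 \<Longrightarrow> \<exists>R. AE x in lebesgue. norm x > R \<longrightarrow> \<bar>\<phi> x - 1\<bar> < \<epsilon>"
proof -
  note * = assms[unfolded stationary_solution_def]
  show "compact K \<Longrightarrow> set_integrable lebesgue K \<phi>"
    by (rule *[THEN conjunct1, THEN spec, THEN mp])
  show "AE x in lebesgue. x \<in> - H \<longrightarrow> conv J \<phi> x = \<phi> x"
    by (rule *[THEN conjunct2, THEN conjunct1])
  show "AE x in lebesgue. x \<in> H \<longrightarrow> \<phi> x = 0"
    by (rule *[THEN conjunct2, THEN conjunct2, THEN conjunct1])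
  show "\<epsilon> > 0 \<Longrightarrow> \<exists>R. AE x in lebesgue. norm x > R \<longrightarrow> \<bar>\<phi> x - 1\<bar> < \<epsilon>"
    by (rule *[THEN conjunct2, THEN conjunct2, THEN conjunct2, THEN spec, THEN mp])
qed

lemma borel_measurable_stationary_solution:
  "stationary_solution J H \<phi> \<Longrightarrow> \<phi> \<in> borel_measurable lebesgue"
  by (rule borel_measurable_locally_integrable) (rule stationary_solutionD(1))

text \<open>
  Outside a ball of radius \<open>R\<close> the limit at infinity gives \<open>\<bar>\<phi>\<bar> < 2\<close>.  Inside, \<open>J * \<phi>\<close> only sees the
  values of \<open>\<phi>\<close> on the ball of radius \<open>R + 1\<close>, where \<open>\<phi>\<close> is integrable, and \<open>J\<close> is bounded.
\<close>

lemma stationary_solution_ess_bounded: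
  fixes J :: "'a::euclidean_space \<Rightarrow> real"
  assumes J: "nonlocal_kernel J" and \<phi>: "stationary_solution J H \<phi>"
  obtains C where "AE x in lebesgue. \<bar>\<phi> x\<bar> \<le> C"
proof -
  obtain M where M: "M \<ge> 0" "\<And>x. \<bar>J x\<bar> \<le> M"
    using nonlocal_kernel_bounded[OF J] by blast
  obtain R where R: "AE x in lebesgue. norm x > R \<longrightarrow> \<bar>\<phi> x - 1\<bar> < 1"
    using stationary_solutionD(4)[OF \<phi> zero_less_one] by (rule exE)
  define K where "K = cball (0::'a) (R + 1)"
  have K: "integrable lebesgue (\<lambda>y. indicator K y *\<^sub>R \<phi> y)"
    using stationary_solutionD(1)[OF \<phi>, of K] by (simp add: K_def set_integrable_def)
  define B where "B = (\<integral>y. M * \<bar>indicator K y *\<^sub>R \<phi> y\<bar> \<partial>lebesgue)"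
  have B: "0 \<le> B"
    unfolding B_def using M by simp
  have conv_bound: "\<bar>conv J \<phi> x\<bar> \<le> B" if x: "norm x \<le> R" for x
  proof -
    have supp: "J (x - y) * \<phi> y = J (x - y) * (indicator K y *\<^sub>R \<phi> y)" for y
    proof (cases "y \<in> K")
      case False
      have "norm y \<le> norm x + norm (x - y)"
        by (metis norm_minus_commute norm_triangle_sub)
      then have "norm (x - y) > 1"
        using False x by (simp add: K_def)
      then show ?thesis
        using nonlocal_kernel_support[OF J] by simp
    qed simp
    have "\<bar>conv J \<phi> x\<bar> \<le> (\<integral>y. \<bar>J (x - y) * (indicator K y *\<^sub>R \<phi> y)\<bar> \<partial>lebesgue)"
      unfolding conv_def supp by (rule integral_abs_bound)
    also have "\<dots> \<le> B"
      unfolding B_def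
    proof (rule integral_mono)
      show "integrable lebesgue (\<lambda>y. \<bar>J (x - y) * (indicator K y *\<^sub>R \<phi> y)\<bar>)"
        using integrable_kernel_times[OF J K] by (rule integrable_abs)
      show "integrable lebesgue (\<lambda>y. M * \<bar>indicator K y *\<^sub>R \<phi> y\<bar>)"
        using K by (intro integrable_mult_right integrable_abs)
      show "\<bar>J (x - y) * (indicator K y *\<^sub>R \<phi> y)\<bar> \<le> M * \<bar>indicator K y *\<^sub>R \<phi> y\<bar>" for y
        unfolding abs_mult[of "J (x - y)"] using M by (intro mult_right_mono) auto
    qed
    finally show ?thesis .
  qed
  from R stationary_solutionD(2,3)[OF \<phi>] have "AE x in lebesgue. \<bar>\<phi> x\<bar> \<le> max 2 B"
  proof eventually_elim
    case (elim x)
    then show ?case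
      using conv_bound[of x] by (cases "x \<in> H"; cases "norm x \<le> R") auto
  qed
  then show ?thesis by (rule that)
qed

section \<open>Conservation of the weighted mass\<close>

text \<open>
  Moving the convolution from \<open>v\<close> onto \<open>\<phi>\<close> leaves \<open>v * (J * \<phi> - \<phi>)\<close>, whose first factor vanishes in
  the hole and whose second factor vanishes outside it.
\<close>

lemma weighted_mass_flux_zero:
  assumes J: "nonlocal_kernel J" and \<phi>: "stationary_solution J H \<phi>"
    and v: "AE x in lebesgue. x \<in> H \<longrightarrow> L1_fun v x = 0"
  shows "(\<integral>x. L1_fun (L1_class (conv J (L1_fun v)) - v) x * \<phi> x \<partial>lebesgue) = 0"
proof -
  note Ji = nonlocal_kernel_integrable[OF J]
  note ic = integrable_conv[OF Ji integrable_L1_fun]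
  have \<phi>m: "\<phi> \<in> borel_measurable lebesgue"
    by (rule borel_measurable_stationary_solution[OF \<phi>])
  obtain C where C: "AE x in lebesgue. \<bar>\<phi> x\<bar> \<le> C"
    using stationary_solution_ess_bounded[OF J \<phi>] by blast
  note int = integrable_times_ess_bounded[OF _ \<phi>m C]
  have vL: "AE x in lebesgue. L1_fun v x * conv J \<phi> x = L1_fun v x * \<phi> x"
    using v stationary_solutionD(2)[OF \<phi>] by eventually_elim auto
  have "(\<integral>x. L1_fun (L1_class (conv J (L1_fun v)) - v) x * \<phi> x \<partial>lebesgue)
      = (\<integral>x. conv J (L1_fun v) x * \<phi> x - L1_fun v x * \<phi> x \<partial>lebesgue)"
  proof (rule integral_cong_AE)
    show "AE x in lebesgue. L1_fun (L1_class (conv J (L1_fun v)) - v) x * \<phi> x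
        = conv J (L1_fun v) x * \<phi> x - L1_fun v x * \<phi> x"
      using L1_fun_diff[of "L1_class (conv J (L1_fun v))" v] L1_fun_L1_class[OF ic[of v]]
      by eventually_elim (simp add: left_diff_distrib)
  qed (intro borel_measurable_diff borel_measurable_integrable int integrable_L1_fun ic)+
  also have "\<dots> = (\<integral>x. conv J (L1_fun v) x * \<phi> x \<partial>lebesgue) - (\<integral>x. L1_fun v x * \<phi> x \<partial>lebesgue)"
    by (intro Bochner_Integration.integral_diff int ic integrable_L1_fun)
  also have "(\<integral>x. conv J (L1_fun v) x * \<phi> x \<partial>lebesgue) = (\<integral>x. L1_fun v x * conv J \<phi> x \<partial>lebesgue)"
    by (rule conv_self_adjoint[OF Ji nonlocal_kernel_even[OF J] integrable_L1_fun \<phi>m C])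
  also have "\<dots> = (\<integral>x. L1_fun v x * \<phi> x \<partial>lebesgue)"
  proof (rule integral_cong_AE[OF _ _ vL])
    show "(\<lambda>x. L1_fun v x * \<phi> x) \<in> borel_measurable lebesgue"
      by (intro borel_measurable_integrable int integrable_L1_fun)
    then show "(\<lambda>x. L1_fun v x * conv J \<phi> x) \<in> borel_measurable lebesgue"
      by (rule borel_measurable_AE) (use vL in auto)
  qed
  finally show ?thesis by simp
qed

theorem proposition4p1:
  fixes J u0 \<phi> :: "real ^ 'n \<Rightarrow> real"
    and H :: "(real ^ 'n) set"
    and u :: "real \<Rightarrow> (real ^ 'n) L1"
  assumes "CARD('n) \<ge> 3"
    and "hole H"
    and "nonlocal_kernel J"
    and "integrable lebesgue u0"
    and "\<exists>C. AE x in lebesgue. \<bar>u0 x\<bar> \<le> C"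
    and "AE x in lebesgue. 0 \<le> u0 x"
    and "AE x in lebesgue. x \<in> H \<longrightarrow> u0 x = 0"
    and "nonlocal_solution J H u0 u"
    and "stationary_solution J H \<phi>"
  shows "\<forall>t>0. integrable lebesgue (\<lambda>x. L1_fun (u t) x * \<phi> x) \<and>
           integrable lebesgue (\<lambda>x. u0 x * \<phi> x) \<and>
           (\<integral>x. L1_fun (u t) x * \<phi> x \<partial>lebesgue) = (\<integral>x. u0 x * \<phi> x \<partial>lebesgue)"
proof (intro allI impI)
  fix t :: real assume t: "t > 0"
  note J = assms(3) and u0 = assms(4) and u = assms(8) and \<phi> = assms(9)
  have \<phi>m: "\<phi> \<in> borel_measurable lebesgue"
    by (rule borel_measurable_stationary_solution[OF \<phi>])
  obtain C where C: "AE x in lebesgue. \<bar>\<phi> x\<bar> \<le> C"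
    using stationary_solution_ess_bounded[OF J \<phi>] by blast
  note int = integrable_times_ess_bounded[OF _ \<phi>m C]
  define F where "F v = (\<integral>x. L1_fun v x * \<phi> x \<partial>lebesgue)" for v
  have F: "bounded_linear F"
    using bounded_linear_L1_pairing[OF \<phi>m C] by (simp add: F_def[abs_def])
  define flux where "flux s = L1_class (conv J (L1_fun (u s))) - u s" for s
  have "continuous_on {0..t} u"
    using u unfolding nonlocal_solution_def by (auto intro: continuous_on_subset)
  then have "continuous_on {0..t} flux"
    unfolding flux_def
    by (intro continuous_on_diff bounded_linear.continuous_on[OF bounded_linear_conv_L1[OF J]])
  then have flux_int: "flux integrable_on {0..t}"
    by (rule integrable_continuous_interval)
  have flux_zero: "F (flux s) = 0" if s: "s > 0" for s
  proof -
    have "AE x in lebesgue. x \<in> H \<longrightarrow> L1_fun (u s) x = 0"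
      using u s unfolding nonlocal_solution_def by blast
    then show ?thesis
      unfolding F_def flux_def by (rule weighted_mass_flux_zero[OF J \<phi>])
  qed
  have "F (integral {0..t} flux) = integral {0..t} (F \<circ> flux)"
    by (rule integral_linear[OF flux_int F, symmetric])
  \<comment> \<open>The boundary condition is imposed at positive times only, so time zero is discarded as a null set.\<close>
  also have "\<dots> = integral {0..t} (\<lambda>_. 0)"
    by (rule integral_spike[of "{0}"]) (auto simp: flux_zero)
  finally have F0: "F (integral {0..t} flux) = 0" by simp
  have "AE x in lebesgue. x \<in> - H \<longrightarrow> L1_fun (u t) x = u0 x + L1_fun (integral {0..t} flux) x"
    using u t unfolding nonlocal_solution_def flux_def by blast
  \<comment> \<open>The equation for \<open>u t\<close> holds outside the hole only, but after multiplication by \<open>\<phi>\<close> it holds in all of space.\<close>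
  with stationary_solutionD(3)[OF \<phi>] have "AE x in lebesgue. L1_fun (u t) x * \<phi> x
      = u0 x * \<phi> x + L1_fun (integral {0..t} flux) x * \<phi> x"
    by eventually_elim (auto simp: distrib_right)
  then have "F (u t) = (\<integral>x. u0 x * \<phi> x + L1_fun (integral {0..t} flux) x * \<phi> x \<partial>lebesgue)"
    unfolding F_def
    by (intro integral_cong_AE borel_measurable_add borel_measurable_integrable int integrable_L1_fun u0)
  also have "\<dots> = (\<integral>x. u0 x * \<phi> x \<partial>lebesgue) + F (integral {0..t} flux)"
    unfolding F_def by (intro Bochner_Integration.integral_add int integrable_L1_fun u0)
  finally show "integrable lebesgue (\<lambda>x. L1_fun (u t) x * \<phi> x) \<and>
      integrable lebesgue (\<lambda>x. u0 x * \<phi> x) \<and>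
      (\<integral>x. L1_fun (u t) x * \<phi> x \<partial>lebesgue) = (\<integral>x. u0 x * \<phi> x \<partial>lebesgue)"
    using F0 by (simp add: int integrable_L1_fun u0 F_def)
qed

end
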